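(* Let $G$ be a finite abelian group and let $S \subseteq G\setminus\{0\}$ be a symmetric subset (i.e. $S=-S$). Let $H_0$ be an arbitrary finite graph, and let $H$ be an even subdivision of $H_0$. Then \[ t(H,\mathrm{Cay}(G,S)) \;\geq\; t(K_2,\mathrm{Cay}(G,S))^{e(H)}. \]
   Context: For graphs $H$ and $F$, a homomorphism from $H$ to $F$ is a map $\phi:V(H)\to V(F)$ such that $\phi(u)\phi(v)\in E(F)$ whenever $uv\in E(H)$; $\hom(H,F)$ denotes the number of homomorphisms and $t(H,F)=\hom(H,F)/v(F)^{v(H)}$ is the homomorphism density, where $v(\cdot)$ and $e(\cdot)$ denote the numbers of vertices and edges. For a finite abelian group $G$ (written additively) and a symmetric subset $S\subseteq G\setminus\{0\}$, the Cayley graph $\mathrm{Cay}(G,S)$ has vertex set $G$, with $x,y$ adjacent iff $y-x\in S$. An even subdivision of a graph $H_0$ is a graph obtained from $H_0$ by replacing each edge by a path of even (positive) length, where different edges may receive different lengths. $K_2$ is the graph consisting of a single edge. *)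

theory Defs
  imports Complex_Main "HOL-Library.FuncSet" "Graph_Theory.Kuratowski"
begin

text \<open>
  A finite simple graph is a \<^locale>\<open>pair_graph\<close>, i.e. a finite, loop-free, symmetric set of arcs
  on a finite vertex set. Each undirected edge is thus represented by two opposite arcs, so edges
  have to be counted as unordered pairs.
\<close>

definition num_edges :: "'a pair_pre_digraph \<Rightarrow> nat" where
  "num_edges H = card ((\<lambda>(u, v). {u, v}) ` parcs H)"

text \<open>Homomorphisms are extensional functions, so that they can be counted as maps on the vertices.\<close>

definition graph_homs :: "'a pair_pre_digraph \<Rightarrow> 'b pair_pre_digraph \<Rightarrow> ('a \<Rightarrow> 'b) set" where
  "graph_homs H F =
     {\<phi> \<in> pverts H \<rightarrow>\<^sub>E pverts F. \<forall>(u, v) \<in> parcs H. (\<phi> u, \<phi> v) \<in> parcs F}"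

definition hom_density :: "'a pair_pre_digraph \<Rightarrow> 'b pair_pre_digraph \<Rightarrow> real" where
  "hom_density H F =
     real (card (graph_homs H F)) / real (card (pverts F)) ^ card (pverts H)"

definition K2 :: "bool pair_pre_digraph" where
  "K2 = \<lparr> pverts = UNIV, parcs = {(u, v). u \<noteq> v} \<rparr>"

lemma complete_digraph_K2: "complete_digraph 2 (with_proj K2)"
  by (simp add: complete_digraph_pair_def K2_def card_UNIV_bool)

definition Cay :: "'g::ab_group_add set \<Rightarrow> 'g pair_pre_digraph" where
  "Cay S = \<lparr> pverts = UNIV, parcs = {(x, y). y - x \<in> S} \<rparr>"

text \<open>
  \<^term>\<open>b\<close> embeds the vertices of \<^term>\<open>H0\<close> as the branch vertices of \<^term>\<open>H\<close>, and
  \<^term>\<open>P (u, v)\<close> is the list of arcs of the path replacing the edge \<open>uv\<close>, traversed from \<^term>\<open>b u\<close>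
  to \<^term>\<open>b v\<close>; the two orientations of an edge give the same path, reversed. The predicate
  \<^const>\<open>pre_digraph.gen_iapath\<close> says that the path is simple, has positive length, has its ends
  among the branch vertices and has no branch vertex in its interior.
\<close>

definition even_subdivision :: "'a pair_pre_digraph \<Rightarrow> 'b pair_pre_digraph \<Rightarrow> bool" where
  "even_subdivision H0 H \<longleftrightarrow>
     (\<exists>b P. inj_on b (pverts H0) \<and>
        (\<forall>(u, v) \<in> parcs H0.
           pre_digraph.gen_iapath (with_proj H) (b ` pverts H0) (b u) (P (u, v)) (b v) \<and>
           even (length (P (u, v))) \<and>
           P (v, u) = rev_path (P (u, v))) \<and>
        (\<forall>(u, v) \<in> parcs H0. \<forall>(u', v') \<in> parcs H0. {u, v} \<noteq> {u', v'} \<longrightarrow>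
           set (pre_digraph.inner_verts (with_proj H) (P (u, v))) \<inter>
           set (pre_digraph.inner_verts (with_proj H) (P (u', v'))) = {}) \<and>
        pverts H = b ` pverts H0 \<union>
          (\<Union>e \<in> parcs H0. set (pre_digraph.inner_verts (with_proj H) (P e))) \<and>
        parcs H = (\<Union>e \<in> parcs H0. set (P e)))"

end

(*
  Orient every edge e = uv of H0, let 2 k_e be the length of the path that replaces it, and cut this
  path at its midpoint. Reading a homomorphism H -> Cay(G, S) along the paths identifies it with a
  map phi : V(H0) -> G together with labels in S on the edges of H such that phi(v) - phi(u) is the
  sum of the labels along the path of uv. Since S = -S, pairs (phi, t), (psi, t') of vertex maps and
  labellings of the half paths with the same image under
    F(phi, t) = (phi(u) - phi(v) + sum of the k_e labels t)_e, with values in G^E(H0),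
  correspond to a homomorphism (vertex map phi - psi, labels t and -t') and an arbitrary psi.
  By the Cauchy-Schwarz inequality F has at least |domain|^2 / |G|^e(H0) collisions, hence
  hom(H, Cay(G, S)) >= |G|^(v(H0) - e(H0)) |S|^e(H), and v(H) = v(H0) - e(H0) + e(H).
*)
theory Submission
  imports Defs "HOL-Library.Cardinality" "HOL-Analysis.Convex"
begin

section \<open>Collision counting and auxiliary facts on sums and lists\<close>

text \<open>The collisions number the sum of the squared fibre sizes of \<open>f\<close>, while the
  fibre sizes themselves sum to \<open>card A\<close>; Cauchy-Schwarz over \<open>B\<close> compares
  the two.\<close>

lemma card_square_le_collisions:
  assumes "finite A" "finite B" "f ` A \<subseteq> B"
  shows "(card A)\<^sup>2 \<le> card B * card {(x, y) \<in> A \<times> A. f x = f y}"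
proof -
  define c where "c y = card {x \<in> A. f x = y}" for y
  have "card A = (\<Sum>y\<in>B. c y)"
    using sum.group[OF assms, of "\<lambda>_. 1::nat"] by (simp add: c_def)
  then have "real ((card A)\<^sup>2) = (\<Sum>y\<in>B. real (c y))\<^sup>2" by simp
  also have "\<dots> \<le> (\<Sum>y\<in>B. (real (c y))\<^sup>2) * real (card B)"
    by (rule sum_squared_le_sum_of_squares)
  also have "\<dots> = real (card B * (\<Sum>y\<in>B. (c y)\<^sup>2))" by simp
  finally have "(card A)\<^sup>2 \<le> card B * (\<Sum>y\<in>B. (c y)\<^sup>2)"
    by (simp only: of_nat_le_iff)
  \<comment> \<open>Each square is spread over its fibre, one summand \<open>c (f x)\<close> per
    point, so that regrouping by fibres turns the sum into one over \<open>A\<close>.\<close>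
  also have "(\<Sum>y\<in>B. (c y)\<^sup>2) = (\<Sum>y\<in>B. \<Sum>x | x \<in> A \<and> f x = y. c (f x))"
    by (simp add: c_def power2_eq_square)
  also have "\<dots> = (\<Sum>x\<in>A. c (f x))" by (rule sum.group[OF assms])
  also have "\<dots> = card (SIGMA x:A. {y \<in> A. f y = f x})"
    using assms(1) by (simp add: c_def)
  also have "(SIGMA x:A. {y \<in> A. f y = f x}) = {(x, y) \<in> A \<times> A. f x = f y}" by auto
  finally show ?thesis .
qed

lemma sum_lessThan_add:
  fixes f :: "nat \<Rightarrow> 'a::comm_monoid_add"
  shows "(\<Sum>i<m + n. f i) = (\<Sum>i<m. f i) + (\<Sum>i<n. f (m + i))"
  by (induction n) (simp_all add: add.assoc)

lemma set_tl_conv_nth: "set (tl xs) = (!) xs ` {0<..<length xs}"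
proof (cases xs)
  case (Cons y ys)
  have "{0<..<length xs} = Suc ` {..<length ys}"
    using Cons by (auto simp: image_Suc_lessThan)
  then show ?thesis using Cons by (auto simp: set_conv_nth image_image)
qed simp

section \<open>Indexed systems of even paths: vertex and edge counts\<close>

text \<open>An index-based form of an even subdivision. \<open>E\<close> is meant to contain one
  orientation of each edge of the original graph, and \<open>k e\<close> is half the path length, so
  that the midpoint has index \<open>k e\<close>. Numbering the vertices of a path makes group sums
  along it sums over initial segments.\<close>

locale even_path_system =
  fixes V :: "'a set" and E :: "('a \<times> 'a) set" and b :: "'a \<Rightarrow> 'b"
    and k :: "'a \<times> 'a \<Rightarrow> nat" and p :: "'a \<times> 'a \<Rightarrow> nat \<Rightarrow> 'b" and H :: "'b pair_pre_digraph"
  assumes finite_V: "finite V"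
    and E_subset: "E \<subseteq> V \<times> V"
    and no_loop: "e \<in> E \<Longrightarrow> fst e \<noteq> snd e"
    and inj_b: "inj_on b V"
    and k_pos: "e \<in> E \<Longrightarrow> 0 < k e"
    and p_0: "e \<in> E \<Longrightarrow> p e 0 = b (fst e)"
    and p_end: "e \<in> E \<Longrightarrow> p e (2 * k e) = b (snd e)"
    and p_inner: "\<lbrakk>e \<in> E; 0 < i; i < 2 * k e\<rbrakk> \<Longrightarrow> p e i \<notin> b ` V"
    and p_inner_inj: "\<lbrakk>e \<in> E; 0 < i; i < 2 * k e; e' \<in> E; 0 < j; j < 2 * k e'; p e i = p e' j\<rbrakk>
      \<Longrightarrow> e = e' \<and> i = j"
    and pverts_H: "pverts H = b ` V \<union> (\<Union>e\<in>E. p e ` {0<..<2 * k e})"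
    and parcs_H: "parcs H = (\<Union>e\<in>E. \<Union>i<2 * k e. {(p e i, p e (Suc i)), (p e (Suc i), p e i)})"
begin

lemma finite_E: "finite E"
  using finite_subset[OF E_subset] finite_V by blast

lemma fst_E: "e \<in> E \<Longrightarrow> fst e \<in> V" and snd_E: "e \<in> E \<Longrightarrow> snd e \<in> V"
  using E_subset by auto

lemma p_branch_iff:
  assumes "e \<in> E" "i \<le> 2 * k e"
  shows "p e i \<in> b ` V \<longleftrightarrow> i = 0 \<or> i = 2 * k e"
  using assms(2) p_0[OF assms(1)] p_end[OF assms(1)] fst_E[OF assms(1)] snd_E[OF assms(1)]
    p_inner[OF assms(1), of i]
  by (cases "i = 0 \<or> i = 2 * k e") auto

lemma p_inner_eq:
  assumes "e \<in> E" "0 < i" "i < 2 * k e" "e' \<in> E" "j \<le> 2 * k e'" "p e i = p e' j"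
  shows "e = e' \<and> i = j"
proof -
  have "0 < j \<and> j < 2 * k e'"
    using p_inner[OF assms(1-3)] p_branch_iff[OF assms(4,5)] assms(5,6) by auto
  then show ?thesis using p_inner_inj assms by blast
qed

text \<open>Inner vertices are separated by \<open>p_inner_inj\<close> and differ from branch
  vertices; the two ends differ because \<open>e\<close> is not a loop and \<open>b\<close> is
  injective.\<close>

lemma inj_on_p:
  assumes "e \<in> E"
  shows "inj_on (p e) {..2 * k e}"
proof (rule inj_onI)
  fix i j assume ij: "i \<in> {..2 * k e}" "j \<in> {..2 * k e}" and eq: "p e i = p e j"
  show "i = j"
  proof (cases "p e i \<in> b ` V")
    case True
    have "p e 0 \<noteq> p e (2 * k e)"
      using no_loop[OF assms] inj_onD[OF inj_b _ fst_E[OF assms] snd_E[OF assms]]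
        p_0[OF assms] p_end[OF assms] by metis
    then show ?thesis
      using True ij eq p_branch_iff[OF assms, of i] p_branch_iff[OF assms, of j] by auto
  next
    case False
    then have "0 < i" "i < 2 * k e" using p_branch_iff[OF assms, of i] ij by auto
    then show ?thesis using p_inner_eq[OF assms _ _ assms] ij eq by blast
  qed
qed

text \<open>A path of length \<open>2 * k e\<close> contributes at most \<open>2 * k e - 1\<close>
  inner vertices. Moving \<open>card E\<close> to the left avoids truncated subtraction.\<close>

lemma card_pverts_le: "card (pverts H) + card E \<le> card V + (\<Sum>e\<in>E. 2 * k e)"
proof -
  have "card (pverts H) \<le> card (b ` V) + card (\<Union>e\<in>E. p e ` {0<..<2 * k e})"
    unfolding pverts_H by (rule card_Un_le)
  also have "card (b ` V) \<le> card V" by (rule card_image_le[OF finite_V])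
  also have "card (\<Union>e\<in>E. p e ` {0<..<2 * k e}) \<le> (\<Sum>e\<in>E. card (p e ` {0<..<2 * k e}))"
    by (rule card_UN_le[OF finite_E])
  also have "\<dots> \<le> (\<Sum>e\<in>E. 2 * k e - 1)"
    by (intro sum_mono order_trans[OF card_image_le]) auto
  finally have "card (pverts H) + card E \<le> card V + ((\<Sum>e\<in>E. 2 * k e - 1) + (\<Sum>e\<in>E. 1))"
    by simp
  also have "(\<Sum>e\<in>E. 2 * k e - 1) + (\<Sum>e\<in>E. 1) = (\<Sum>e\<in>E. 2 * k e)"
    unfolding sum.distrib[symmetric] using k_pos by (intro sum.cong) fastforce+
  finally show ?thesis .
qed

lemma arc_of_path: "\<lbrakk>e \<in> E; i < 2 * k e\<rbrakk> \<Longrightarrow> (p e i, p e (Suc i)) \<in> parcs H"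
  unfolding parcs_H by blast

text \<open>Distinct positions \<open>(e, i)\<close> give distinct unordered edges of
  \<open>H\<close>: an inner vertex on the edge determines the path, and injectivity along the path
  then determines the position.\<close>

lemma num_edges_ge: "(\<Sum>e\<in>E. 2 * k e) \<le> num_edges H"
proof -
  let ?A = "SIGMA e:E. {..<2 * k e}"
  let ?f = "\<lambda>(e, i). {p e i, p e (Suc i)}"
  have "inj_on ?f ?A"
  proof (rule inj_onI)
    fix x y assume A: "x \<in> ?A" "y \<in> ?A" and f: "?f x = ?f y"
    obtain e i e' j where xy: "x = (e, i)" "y = (e', j)" by (metis surj_pair)
    then have e: "e \<in> E" "e' \<in> E" and ij: "i < 2 * k e" "j < 2 * k e'"
      and eq: "{p e i, p e (Suc i)} = {p e' j, p e' (Suc j)}"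
      using A f by auto
    txt \<open>A path of length at least 2 has an inner vertex on each of its edges.\<close>
    have "\<exists>m. 0 < m \<and> m < 2 * k e \<and> (m = i \<or> m = Suc i)"
      using ij k_pos[OF e(1)] by (cases "i = 0") auto
    then obtain m where m: "0 < m" "m < 2 * k e" "p e m \<in> {p e i, p e (Suc i)}"
      by blast
    then obtain m' where "m' \<le> 2 * k e'" "p e m = p e' m'"
      unfolding eq using ij by (metis Suc_leI insertE less_imp_le singletonD)
    note m = m(1,2) this
    then have ee: "e = e'" using p_inner_eq[OF e(1) m(1,2) e(2) m(3,4)] by blast
    \<comment> \<open>Injectivity of \<open>p e\<close> pulls the equality back to the index pairs,
      and consecutive pairs of naturals agree only if they start at the same index.\<close>
    have "p e ` {i, Suc i} = p e ` {j, Suc j}"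
      using eq ee by simp
    then have "{i, Suc i} = {j, Suc j}"
      using ij ee by (subst (asm) inj_on_image_eq_iff[OF inj_on_p[OF e(1)]]) auto
    then have "i = j" by (auto simp: doubleton_eq_iff)
    with ee xy show "x = y" by simp
  qed
  then have "card ?A = card (?f ` ?A)" by (simp add: card_image)
  also have "\<dots> \<le> num_edges H"
    unfolding num_edges_def
  proof (rule card_mono)
    show "finite ((\<lambda>(u, v). {u, v}) ` parcs H)"
      unfolding parcs_H using finite_E by auto
    show "?f ` ?A \<subseteq> (\<lambda>(u, v). {u, v}) ` parcs H"
      by clarify (rule image_eqI[OF _ arc_of_path], simp_all)
  qed
  finally show ?thesis using finite_E by simp
qed

section \<open>Labellings of the paths as homomorphisms to the Cayley graph\<close>

text \<open>The label \<open>s (e, i)\<close> stands for the increment of a homomorphism along arc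
  \<open>i\<close> of path \<open>e\<close>; the condition is the telescoped total
  increment.\<close>

definition labellings :: "'g::ab_group_add set \<Rightarrow> (('a \<Rightarrow> 'g) \<times> (('a \<times> 'a) \<times> nat \<Rightarrow> 'g)) set" where
  "labellings S = {(\<phi>, s) \<in> (V \<rightarrow>\<^sub>E UNIV) \<times> ((SIGMA e:E. {..<2 * k e}) \<rightarrow>\<^sub>E S).
     \<forall>e\<in>E. \<phi> (snd e) - \<phi> (fst e) = (\<Sum>i<2 * k e. s (e, i))}"

text \<open>The choice operator recovers the position of an inner vertex, which is unique by
  \<open>p_inner_inj\<close>. The value \<open>undefined\<close> off \<open>pverts H\<close> makes
  the map extensional, as \<open>graph_homs\<close> demands.\<close>

definition labelling_hom :: "('a \<Rightarrow> 'g::ab_group_add) \<times> (('a \<times> 'a) \<times> nat \<Rightarrow> 'g) \<Rightarrow> 'b \<Rightarrow> 'g" where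
  "labelling_hom = (\<lambda>(\<phi>, s) x.
     if x \<in> b ` V then \<phi> (inv_into V b x)
     else if x \<in> pverts H then
       (let (e, i) = SOME (e, i). e \<in> E \<and> 0 < i \<and> i < 2 * k e \<and> p e i = x
        in \<phi> (fst e) + (\<Sum>j<i. s (e, j)))
     else undefined)"

lemma labelling_hom_branch: "v \<in> V \<Longrightarrow> labelling_hom (\<phi>, s) (b v) = \<phi> v"
  using inj_b by (simp add: labelling_hom_def)

text \<open>Partial sums from the start of the path describe all its vertices; at the far end this
  agrees with the value of \<open>\<phi>\<close> by the sum condition in
  \<open>labellings\<close>.\<close>

lemma labelling_hom_path:
  assumes "(\<phi>, s) \<in> labellings S" "e \<in> E" "i \<le> 2 * k e"
  shows "labelling_hom (\<phi>, s) (p e i) = \<phi> (fst e) + (\<Sum>j<i. s (e, j))"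
proof -
  consider "i = 0" | "i = 2 * k e" | "0 < i" "i < 2 * k e" using assms(3) by linarith
  then show ?thesis
  proof cases
    case 1
    then show ?thesis using assms(2) by (simp add: p_0 fst_E labelling_hom_branch)
  next
    case 2
    have "\<phi> (snd e) - \<phi> (fst e) = (\<Sum>j<2 * k e. s (e, j))"
      using assms(1,2) by (simp add: labellings_def)
    then have "\<phi> (snd e) = \<phi> (fst e) + (\<Sum>j<2 * k e. s (e, j))"
      by (metis add_diff_cancel_left' diff_add_cancel add.commute)
    then show ?thesis
      using 2 assms(2) by (simp add: p_end snd_E labelling_hom_branch)
  next
    case 3
    let ?P = "\<lambda>(e', j). e' \<in> E \<and> 0 < j \<and> j < 2 * k e' \<and> p e' j = p e i"
    have "(SOME x. ?P x) = (e, i)"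
    proof (rule some_equality)
      fix x assume P: "?P x"
      obtain e' j where x: "x = (e', j)" by (cases x)
      then show "x = (e, i)"
        using P p_inner_inj[OF assms(2) 3, of e' j] by auto
    qed (use 3 assms(2) in simp)
    moreover have "p e i \<in> p e ` {0<..<2 * k e}" using 3 by simp
    then have "p e i \<in> pverts H" unfolding pverts_H using assms(2) by blast
    ultimately show ?thesis
      using p_inner[OF assms(2) 3] by (simp add: labelling_hom_def)
  qed
qed

lemma labelling_hom_step:
  assumes "(\<phi>, s) \<in> labellings S" "e \<in> E" "i < 2 * k e"
  shows "labelling_hom (\<phi>, s) (p e (Suc i)) - labelling_hom (\<phi>, s) (p e i) = s (e, i)"
  using labelling_hom_path[OF assms(1,2), of i] labelling_hom_path[OF assms(1,2), of "Suc i"] assms(3)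
  by simp

text \<open>The increment along an arc is a label in \<open>S\<close>, or the negative of one if the
  arc runs against the path; symmetry of \<open>S\<close> covers the second case.\<close>

lemma labelling_hom_in_homs:
  assumes "uminus ` S = S" "\<phi>s \<in> labellings S"
  shows "labelling_hom \<phi>s \<in> graph_homs H (Cay S)"
proof -
  obtain \<phi> s where \<phi>s: "\<phi>s = (\<phi>, s)" by force
  have "s (e, i) \<in> S" if "e \<in> E" "i < 2 * k e" for e i
    using assms(2) that unfolding \<phi>s labellings_def by (auto simp: PiE_iff)
  moreover have "- x \<in> S" if "x \<in> S" for x
    using assms(1) that by blast
  ultimately have S: "s (e, i) \<in> S" "- s (e, i) \<in> S" if "e \<in> E" "i < 2 * k e" for e i
    using that by blast+
  have "labelling_hom \<phi>s y - labelling_hom \<phi>s x \<in> S" if "(x, y) \<in> parcs H" for x y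
  proof -
    from that obtain e i where e: "e \<in> E" "i < 2 * k e"
      and xy: "x = p e i \<and> y = p e (Suc i) \<or> x = p e (Suc i) \<and> y = p e i"
      unfolding parcs_H by blast
    have step: "labelling_hom \<phi>s (p e (Suc i)) - labelling_hom \<phi>s (p e i) = s (e, i)"
      using labelling_hom_step assms(2) e unfolding \<phi>s by blast
    then have "labelling_hom \<phi>s (p e i) - labelling_hom \<phi>s (p e (Suc i)) = - s (e, i)"
      by (metis minus_diff_eq)
    with step show ?thesis using S[OF e] xy by metis
  qed
  moreover have "labelling_hom \<phi>s \<in> pverts H \<rightarrow>\<^sub>E UNIV"
    unfolding \<phi>s by (auto simp: labelling_hom_def PiE_iff extensional_def pverts_H)
  ultimately show ?thesis
    by (auto simp: graph_homs_def Cay_def)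
qed

text \<open>The vertex map is read off at the branch vertices and each label as a difference of
  consecutive values.\<close>

lemma inj_labelling_hom: "inj_on labelling_hom (labellings S)"
proof (rule inj_onI, clarify)
  fix \<phi> s \<phi>' s'
  assume X: "(\<phi>, s) \<in> labellings S" "(\<phi>', s') \<in> labellings S"
    and eq: "labelling_hom (\<phi>, s) = labelling_hom (\<phi>', s')"
  have "\<phi> = \<phi>'"
  proof (rule PiE_ext)
    show "\<phi> \<in> V \<rightarrow>\<^sub>E UNIV" "\<phi>' \<in> V \<rightarrow>\<^sub>E UNIV" using X by (auto simp: labellings_def)
    show "\<phi> v = \<phi>' v" if "v \<in> V" for v
      using labelling_hom_branch[OF that] eq by metis
  qed
  moreover have "s = s'"
  proof (rule PiE_ext)
    show "s \<in> (SIGMA e:E. {..<2 * k e}) \<rightarrow>\<^sub>E S" "s' \<in> (SIGMA e:E. {..<2 * k e}) \<rightarrow>\<^sub>E S"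
      using X by (auto simp: labellings_def)
    show "s x = s' x" if "x \<in> (SIGMA e:E. {..<2 * k e})" for x
    proof -
      obtain e i where x: "x = (e, i)" by (cases x)
      then have "e \<in> E" "i < 2 * k e" using that by auto
      then show ?thesis
        using labelling_hom_step[OF X(1)] labelling_hom_step[OF X(2)] eq x by metis
    qed
  qed
  ultimately show "\<phi> = \<phi>' \<and> s = s'" ..
qed

lemma finite_pverts: "finite (pverts H)"
  unfolding pverts_H using finite_V finite_E by auto

lemma card_labellings_le:
  fixes S :: "'g::{finite, ab_group_add} set"
  assumes "uminus ` S = S"
  shows "card (labellings S) \<le> card (graph_homs H (Cay S))"
proof (rule card_inj_on_le[OF inj_labelling_hom])
  show "labelling_hom ` labellings S \<subseteq> graph_homs H (Cay S)"
    using labelling_hom_in_homs[OF assms] by blast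
  have "finite (pverts H \<rightarrow>\<^sub>E (UNIV :: 'g set))"
    using finite_pverts by (simp add: finite_PiE)
  then show "finite (graph_homs H (Cay S))"
    by (rule finite_subset[rotated]) (auto simp: graph_homs_def Cay_def)
qed

section \<open>Lower bound for the number of labellings by collisions\<close>

text \<open>Two half labellings with the same image under \<open>f\<close> glue to a full labelling,
  so a lower bound on collisions bounds \<open>labellings S\<close> from below.\<close>

lemma card_labellings_ge:
  fixes S :: "'g::{finite, ab_group_add} set"
  assumes "uminus ` S = S"
  shows "CARD('g) ^ card V * card S ^ (\<Sum>e\<in>E. 2 * k e) \<le> CARD('g) ^ card E * card (labellings S)"
proof -
  let ?T = "SIGMA e:E. {..<k e}"
  let ?M = "V \<rightarrow>\<^sub>E (UNIV :: 'g set)"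
  define A where "A = ?M \<times> (?T \<rightarrow>\<^sub>E S)"
  \<comment> \<open>The signs are chosen so that a collision of \<open>(\<phi>, t)\<close> and
    \<open>(\<psi>, t')\<close> says that \<open>\<phi> - \<psi>\<close> increases along
    \<open>e\<close> by the sum of \<open>t\<close> minus the sum of \<open>t'\<close>.\<close>
  define f where "f = (\<lambda>(\<phi> :: 'a \<Rightarrow> 'g, t). \<lambda>e\<in>E. \<phi> (fst e) - \<phi> (snd e) + (\<Sum>i<k e. t (e, i)))"
  define C where "C = {(x, y) \<in> A \<times> A. f x = f y}"
  \<comment> \<open>The second half carries the negated labels \<open>t'\<close>, shifted by
    \<open>k e\<close>; their order is immaterial as only sums in an abelian group matter. Keeping
    \<open>\<psi>\<close> makes \<open>join\<close> injective.\<close>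
  define join where "join = (\<lambda>((\<phi> :: 'a \<Rightarrow> 'g, t :: ('a \<times> 'a) \<times> nat \<Rightarrow> 'g), (\<psi>, t')).
    ((\<lambda>v\<in>V. \<phi> v - \<psi> v,
      \<lambda>(e, i)\<in>(SIGMA e:E. {..<2 * k e}). if i < k e then t (e, i) else - t' (e, i - k e)), \<psi>))"
  have finT: "finite ?T" using finite_E by auto
  have finM: "finite ?M" using finite_V by (simp add: finite_PiE)
  have finA: "finite A" unfolding A_def using finT finM by (simp add: finite_PiE)
  have cardM: "card ?M = CARD('g) ^ card V" using finite_V by (simp add: card_funcsetE)
  have card_A: "card A = card ?M * card S ^ (\<Sum>e\<in>E. k e)"
    unfolding A_def card_cartesian_product using finT finite_E by (simp add: card_funcsetE)
  have C_ge: "(card A)\<^sup>2 \<le> CARD('g) ^ card E * card C"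
  proof -
    have "(card A)\<^sup>2 \<le> card (E \<rightarrow>\<^sub>E (UNIV :: 'g set)) * card C"
      unfolding C_def using finA finite_E
      by (intro card_square_le_collisions) (auto simp: finite_PiE f_def)
    then show ?thesis using finite_E by (simp add: card_funcsetE)
  qed
  have C_le: "card C \<le> card (labellings S \<times> ?M)"
  proof (rule card_inj_on_le[of join])
    show "inj_on join C"
    proof (rule inj_onI)
      fix x y assume xyC: "x \<in> C" "y \<in> C" and xy_eq: "join x = join y"
      obtain \<phi>1 t1 \<psi>1 r1 where x: "x = ((\<phi>1, t1), (\<psi>1, r1))"
        by (cases x; cases "fst x"; cases "snd x") auto
      obtain \<phi>2 t2 \<psi>2 r2 where y: "y = ((\<phi>2, t2), (\<psi>2, r2))"
        by (cases y; cases "fst y"; cases "snd y") auto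
      note C = xyC[unfolded x y] and eq = xy_eq[unfolded x y]
      let ?D = "SIGMA e:E. {..<2 * k e}"
      have P: "\<phi>1 \<in> ?M" "\<phi>2 \<in> ?M" and
        Q: "t1 \<in> ?T \<rightarrow>\<^sub>E S" "t2 \<in> ?T \<rightarrow>\<^sub>E S" "r1 \<in> ?T \<rightarrow>\<^sub>E S" "r2 \<in> ?T \<rightarrow>\<^sub>E S"
        using C by (auto simp: C_def A_def)
      note eqs = eq[unfolded join_def case_prod_conv prod.inject]
      note psi = conjunct2[OF eqs]
        and eq1 = conjunct1[OF conjunct1[OF eqs]] and eq2 = conjunct2[OF conjunct1[OF eqs]]
      have "\<phi>1 v = \<phi>2 v" if "v \<in> V" for v
        using fun_cong[OF eq1, of v] psi that by simp
      then have phi: "\<phi>1 = \<phi>2" using PiE_ext[OF P] by blast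
      have s: "(if i < k e then t1 (e, i) else - r1 (e, i - k e)) =
          (if i < k e then t2 (e, i) else - r2 (e, i - k e))" if "e \<in> E" "i < 2 * k e" for e i
        using fun_cong[OF eq2, of "(e, i)"] that by simp
      have "t1 x = t2 x \<and> r1 x = r2 x" if "x \<in> ?T" for x
      proof -
        obtain e i where x: "x = (e, i)" by (cases x)
        then have "e \<in> E" "i < k e" using that by auto
        \<comment> \<open>Position \<open>i\<close> lies in the first half and yields the
          \<open>t\<close> labels; position \<open>i + k e\<close> lies in the second and yields the
          \<open>r\<close> labels.\<close>
        then show ?thesis using x s[of e i] s[of e "i + k e"] by simp
      qed
      then have "t1 = t2" "r1 = r2"
        using PiE_ext[OF Q(1,2)] PiE_ext[OF Q(3,4)] by blast+
      then show "x = y" using phi psi x y by simp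
    qed
    show "join ` C \<subseteq> labellings S \<times> ?M"
    proof (rule image_subsetI, clarify)
      fix \<phi> t \<psi> r assume C: "((\<phi>, t), (\<psi>, r)) \<in> C"
      then have t: "t \<in> ?T \<rightarrow>\<^sub>E S" and r: "r \<in> ?T \<rightarrow>\<^sub>E S" and \<psi>: "\<psi> \<in> ?M"
        by (auto simp: C_def A_def)
      define s where "s = (\<lambda>(e, i)\<in>(SIGMA e:E. {..<2 * k e}). if i < k e then t (e, i) else - r (e, i - k e))"
      define \<chi> where "\<chi> = (\<lambda>v\<in>V. \<phi> v - \<psi> v)"
      have S: "- x \<in> S" if "x \<in> S" for x using assms that by blast
      have "s \<in> (SIGMA e:E. {..<2 * k e}) \<rightarrow>\<^sub>E S"
      proof (rule PiE_I)
        fix x assume "x \<in> (SIGMA e:E. {..<2 * k e})"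
        then obtain e i where x: "x = (e, i)" "e \<in> E" "i < 2 * k e" by blast
        show "s x \<in> S"
        proof (cases "i < k e")
          case True
          then have "(e, i) \<in> ?T" using x by simp
          then show ?thesis using PiE_mem[OF t] x True by (simp add: s_def)
        next
          case False
          then have "(e, i - k e) \<in> ?T" using x by simp
          then show ?thesis using S PiE_mem[OF r] x False by (simp add: s_def)
        qed
      qed (simp add: s_def)
      moreover have "\<chi> \<in> ?M" by (simp add: \<chi>_def)
      moreover have "\<chi> (snd e) - \<chi> (fst e) = (\<Sum>i<2 * k e. s (e, i))" if "e \<in> E" for e
      proof -
        have "f (\<phi>, t) e = f (\<psi>, r) e" using C by (simp add: C_def)
        then have *: "\<phi> (fst e) - \<phi> (snd e) + (\<Sum>i<k e. t (e, i)) =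
            \<psi> (fst e) - \<psi> (snd e) + (\<Sum>i<k e. r (e, i))"
          using that by (simp add: f_def)
        have "(\<Sum>i<2 * k e. s (e, i)) = (\<Sum>i<k e + k e. s (e, i))" by (simp add: mult_2)
        also have "\<dots> = (\<Sum>i<k e. s (e, i)) + (\<Sum>i<k e. s (e, k e + i))"
          by (rule sum_lessThan_add)
        also have "\<dots> = (\<Sum>i<k e. t (e, i)) + (\<Sum>i<k e. - r (e, i))"
          using that by (intro arg_cong2[of _ _ _ _ "(+)"] sum.cong) (auto simp: s_def)
        also have "\<dots> = \<chi> (snd e) - \<chi> (fst e)"
          using * that fst_E snd_E by (simp add: \<chi>_def sum_negf algebra_simps)
        finally show ?thesis ..
      qed
      ultimately have "((\<chi>, s), \<psi>) \<in> labellings S \<times> ?M"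
        using \<psi> unfolding labellings_def by blast
      then show "join ((\<phi>, t), (\<psi>, r)) \<in> labellings S \<times> ?M"
        unfolding join_def case_prod_conv s_def \<chi>_def .
    qed
    have "labellings S \<subseteq> ?M \<times> ((SIGMA e:E. {..<2 * k e}) \<rightarrow>\<^sub>E S)"
      by (auto simp: labellings_def)
    moreover have "finite (?M \<times> ((SIGMA e:E. {..<2 * k e}) \<rightarrow>\<^sub>E S))"
      using finM finite_E by (simp add: finite_PiE)
    ultimately show "finite (labellings S \<times> ?M)"
      using finM finite_subset by blast
  qed
  have "(card ?M * card S ^ (\<Sum>e\<in>E. k e))\<^sup>2 \<le> CARD('g) ^ card E * (card (labellings S) * card ?M)"
    using order_trans[OF C_ge mult_le_mono2[OF C_le]] by (simp only: card_A card_cartesian_product)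
  moreover have "card S ^ (\<Sum>e\<in>E. 2 * k e) = (card S ^ (\<Sum>e\<in>E. k e))\<^sup>2"
    by (simp only: mult.commute[of 2] sum_distrib_right[symmetric] power_mult)
  \<comment> \<open>One of the two factors \<open>card ?M\<close> from the square cancels against
    the free choice of \<open>\<psi>\<close>.\<close>
  ultimately have "card ?M * (card ?M * card S ^ (\<Sum>e\<in>E. 2 * k e)) \<le>
      card ?M * (CARD('g) ^ card E * card (labellings S))"
    by (simp only: power2_eq_square mult_ac)
  moreover have "card ?M > 0" unfolding cardM by simp
  ultimately show ?thesis unfolding cardM by simp
qed

end

section \<open>Passage from counts to densities\<close>

text \<open>A homomorphism from \<open>K2\<close> is determined by its value at \<open>False\<close>
  and its increment, which lies in \<open>S\<close>.\<close>

lemma hom_density_K2_le: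
  fixes S :: "'g::{finite, ab_group_add} set"
  shows "hom_density K2 (Cay S) \<le> real (card S) / real CARD('g)"
proof -
  have "card (graph_homs K2 (Cay S)) \<le> card ((UNIV :: 'g set) \<times> S)"
  proof (rule card_inj_on_le[of "\<lambda>\<phi>. (\<phi> False, \<phi> True - \<phi> False)"])
    show "inj_on (\<lambda>\<phi>. (\<phi> False, \<phi> True - \<phi> False)) (graph_homs K2 (Cay S))"
      by (intro inj_onI ext) (metis (full_types) Pair_inject diff_add_cancel)
  qed (auto simp: graph_homs_def K2_def Cay_def dest: spec[of _ True])
  then have "real (card (graph_homs K2 (Cay S))) \<le> real CARD('g) * real (card S)"
    by (metis card_cartesian_product of_nat_le_iff of_nat_mult)
  then show ?thesis
    by (simp add: hom_density_def K2_def Cay_def card_UNIV_bool power2_eq_square field_simps)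
qed

lemma (in even_path_system) hom_density_ge:
  fixes S :: "'g::{finite, ab_group_add} set"
  assumes "uminus ` S = S"
  shows "hom_density K2 (Cay S) ^ num_edges H \<le> hom_density H (Cay S)"
proof -
  let ?n = "real CARD('g)" and ?h = "real (card (graph_homs H (Cay S)))"
    and ?L = "\<Sum>e\<in>E. 2 * k e"
  have n: "?n \<ge> 1" by (simp add: Suc_leI)
  have "real (card S) \<le> ?n" by (simp add: card_mono)
  then have q: "real (card S) / ?n \<le> 1" by simp
  have "CARD('g) ^ card V * card S ^ ?L \<le> CARD('g) ^ card E * card (graph_homs H (Cay S))"
    using card_labellings_ge[OF assms] card_labellings_le[OF assms] by (meson le_trans mult_le_mono2)
  then have "real (CARD('g) ^ card V * card S ^ ?L) \<le> real (CARD('g) ^ card E * card (graph_homs H (Cay S)))"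
    by (rule of_nat_mono)
  then have main: "?n ^ card V * real (card S) ^ ?L \<le> ?n ^ card E * ?h" by simp
  have "?n ^ card V * (real (card S) ^ ?L * ?n ^ card (pverts H)) \<le> ?n ^ card E * ?h * ?n ^ card (pverts H)"
    using mult_right_mono[OF main, of "?n ^ card (pverts H)"] by (simp add: mult_ac)
  also have "\<dots> = ?n ^ (card (pverts H) + card E) * ?h" by (simp add: power_add)
  \<comment> \<open>The bound on the number of vertices enters as a comparison of exponents, using
    \<open>?n \<ge> 1\<close>.\<close>
  also have "\<dots> \<le> ?n ^ (card V + ?L) * ?h"
    using card_pverts_le n by (intro mult_right_mono power_increasing) auto
  also have "\<dots> = ?n ^ card V * (?h * ?n ^ ?L)" by (simp add: power_add)
  finally have "real (card S) ^ ?L * ?n ^ card (pverts H) \<le> ?h * ?n ^ ?L"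
    using n by simp
  then have "(real (card S) / ?n) ^ ?L \<le> hom_density H (Cay S)"
    using n by (simp add: hom_density_def Cay_def power_divide field_simps)
  moreover have "hom_density K2 (Cay S) ^ num_edges H \<le> (real (card S) / ?n) ^ num_edges H"
    by (intro power_mono hom_density_K2_le) (simp add: hom_density_def)
  \<comment> \<open>The base is at most 1 and \<open>?L\<close> is at most the number of edges, so
    lowering the exponent to \<open>?L\<close> cannot decrease the power.\<close>
  moreover have "\<dots> \<le> (real (card S) / ?n) ^ ?L"
    using num_edges_ge q by (intro power_decreasing) auto
  ultimately show ?thesis by linarith
qed

section \<open>From even subdivisions to path systems\<close>

text \<open>Number the vertices injectively by naturals and keep the arcs that go upwards.\<close>

lemma orientation_exists:
  assumes "finite A" and loopfree: "\<And>u v. (u, v) \<in> A \<Longrightarrow> u \<noteq> v"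
    and sym: "\<And>u v. (u, v) \<in> A \<Longrightarrow> (v, u) \<in> A"
  obtains E where "E \<subseteq> A" "\<And>u v. (u, v) \<in> E \<Longrightarrow> (v, u) \<notin> E"
    "\<And>u v. (u, v) \<in> A \<Longrightarrow> (u, v) \<in> E \<or> (v, u) \<in> E"
proof -
  obtain f :: "'a \<Rightarrow> nat" where f: "inj_on f (fst ` A \<union> snd ` A)"
    using finite_imp_inj_to_nat_seg[of "fst ` A \<union> snd ` A"] assms(1) by auto
  have "f u \<noteq> f v" if "(u, v) \<in> A" for u v
    using loopfree[OF that] f that by (force dest: inj_onD)
  then show ?thesis
    using sym by (intro that[of "{(u, v) \<in> A. f u < f v}"]) (auto simp: nat_neq_iff)
qed

lemma set_rev_path: "set (rev_path p) = prod.swap ` set p"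
  by (induct p) auto

text \<open>An even subdivision describes each path twice, once per orientation; fixing one
  orientation of each edge and numbering the vertices of its path gives the system.\<close>

lemma even_subdivision_path_system:
  fixes H0 :: "'a pair_pre_digraph" and H :: "'b pair_pre_digraph"
  assumes H0: "pair_graph H0" and H: "pair_graph H" and sub: "even_subdivision H0 H"
  shows "\<exists>E b k p. even_path_system (pverts H0) E (b :: 'a \<Rightarrow> 'b) k p H"
proof -
  interpret H0: pair_graph H0 by (rule H0)
  interpret H: pair_graph H by (rule H)
  let ?V = "pverts H0"
  obtain b P where b: "inj_on b ?V"
    and paths: "\<forall>(u, v)\<in>parcs H0. H.gen_iapath (b ` ?V) (b u) (P (u, v)) (b v) \<and>
      even (length (P (u, v))) \<and> P (v, u) = rev_path (P (u, v))"
    and disjoint: "\<forall>(u, v)\<in>parcs H0. \<forall>(u', v')\<in>parcs H0. {u, v} \<noteq> {u', v'} \<longrightarrow>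
      set (H.inner_verts (P (u, v))) \<inter> set (H.inner_verts (P (u', v'))) = {}"
    and verts: "pverts H = b ` ?V \<union> (\<Union>e\<in>parcs H0. set (H.inner_verts (P e)))"
    and arcs: "parcs H = (\<Union>e\<in>parcs H0. set (P e))"
    using sub unfolding even_subdivision_def by (elim exE conjE) (rule that)
  have path: "H.gen_iapath (b ` ?V) (b u) (P (u, v)) (b v)"
    and ev: "even (length (P (u, v)))" and rev: "P (v, u) = rev_path (P (u, v))"
    if "(u, v) \<in> parcs H0" for u v
    using bspec[OF paths that] by simp_all
  have disj: "set (H.inner_verts (P (u, v))) \<inter> set (H.inner_verts (P (u', v'))) = {}"
    if "(u, v) \<in> parcs H0" "(u', v') \<in> parcs H0" "{u, v} \<noteq> {u', v'}" for u v u' v'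
    using bspec[OF bspec[OF disjoint that(1), unfolded case_prod_conv] that(2)] that(3) by simp
  obtain E where E: "E \<subseteq> parcs H0" and anti: "\<And>u v. (u, v) \<in> E \<Longrightarrow> (v, u) \<notin> E"
    and cov: "\<And>u v. (u, v) \<in> parcs H0 \<Longrightarrow> (u, v) \<in> E \<or> (v, u) \<in> E"
    using orientation_exists[OF H0.pair_finite_arcs H0.no_loops'] H0.arcs_symmetric by metis
  define k where "k e = length (P e) div 2" for e
  define p where "p e i = pawalk_verts (b (fst e)) (P e) ! i" for e i
  have len: "length (P e) = 2 * k e" if "e \<in> E" for e
    using ev[of "fst e" "snd e"] that E by (auto simp: k_def)
  have gp: "H.gen_iapath (b ` ?V) (b (fst e)) (P e) (b (snd e))" if "e \<in> E" for e
    using path[of "fst e" "snd e"] that E by auto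
  note gen = gp[unfolded H.gen_iapath_def H.apath_def H.awalk_def]
  \<comment> \<open>The vertex list, one longer than the arc list, is written as the arc sources
    followed by the end and, next, as the start followed by the arc targets. Comparing both forms
    shows that arc \<open>i\<close> runs from \<open>p e i\<close> to
    \<open>p e (Suc i)\<close>.\<close>
  have vs: "pawalk_verts (b (fst e)) (P e) = map fst (P e) @ [b (snd e)]" if "e \<in> E" for e
  proof -
    have "last (pawalk_verts (b (fst e)) (P e)) = b (snd e)"
      using H.awlast_if_cas[of "b (fst e)" "P e" "b (snd e)"] gen[OF that] by simp
    then show ?thesis
      using H.awalk_verts_conv[of "b (fst e)" "P e"] gen[OF that] by simp
  qed
  have vs': "pawalk_verts (b (fst e)) (P e) = b (fst e) # map snd (P e)" if "e \<in> E" for e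
  proof -
    have "hd (pawalk_verts (b (fst e)) (P e)) = b (fst e)"
      using H.awhd_if_cas[of "b (fst e)" "P e" "b (snd e)"] gen[OF that] by simp
    then show ?thesis
      using H.awalk_verts_conv'[of "b (fst e)" "P e" "b (snd e)"] gen[OF that] by simp
  qed
  have p_fst: "p e i = fst (P e ! i)" if "e \<in> E" "i < 2 * k e" for e i
    using that len by (simp add: p_def vs nth_append)
  have p_snd: "p e (Suc i) = snd (P e ! i)" if "e \<in> E" "i < 2 * k e" for e i
    using that len by (simp add: p_def vs')
  have set_P: "set (P e) = (\<Union>i<2 * k e. {(p e i, p e (Suc i))})" if "e \<in> E" for e
    using that len[OF that] by (auto simp: set_conv_nth p_fst p_snd)
  have inner: "set (H.inner_verts (P e)) = p e ` {0<..<2 * k e}" if "e \<in> E" for e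
    using that len p_fst by (simp add: H.inner_verts_def set_tl_conv_nth)
  have P_swap: "P (prod.swap e) = rev_path (P e)" if "e \<in> E" for e
    using rev[of "fst e" "snd e"] that E by (auto simp: prod.swap_def)
  have set_P_swap: "set (P (prod.swap e)) = (\<Union>i<2 * k e. {(p e (Suc i), p e i)})" if "e \<in> E" for e
    by (simp add: P_swap[OF that] set_rev_path set_P[OF that] image_UN)
  have inner_swap: "set (H.inner_verts (P (prod.swap e))) = p e ` {0<..<2 * k e}" if "e \<in> E" for e
  proof -
    have "H.awalk (b (fst e)) (P e) (b (snd e))"
      using gp[OF that] by (simp add: H.gen_iapath_def H.apath_def)
    then show ?thesis
      by (simp add: P_swap[OF that] H.inner_verts_rev_path inner[OF that])
  qed
  \<comment> \<open>Unions over all arcs split into the chosen orientation and its reverse; the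
    reversed paths repeat the inner vertices and supply the opposite arcs.\<close>
  have parcs_E: "parcs H0 = E \<union> prod.swap ` E"
  proof
    show "parcs H0 \<subseteq> E \<union> prod.swap ` E"
    proof
      fix e assume "e \<in> parcs H0"
      then have "e \<in> E \<or> prod.swap e \<in> E" using cov by (cases e) simp
      then show "e \<in> E \<union> prod.swap ` E" by (metis UnI1 UnI2 image_eqI swap_swap)
    qed
    show "E \<union> prod.swap ` E \<subseteq> parcs H0" using E H0.arcs_symmetric by auto
  qed
  have "even_path_system ?V E b k p H"
  proof
    show "finite ?V" by (rule H0.pair_finite_verts)
    show "E \<subseteq> ?V \<times> ?V" using E H0.in_arcsD1 H0.in_arcsD2 by auto
    show "inj_on b ?V" by (rule b)
    show "pverts H = b ` ?V \<union> (\<Union>e\<in>E. p e ` {0<..<2 * k e})"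
      unfolding verts parcs_E UN_Un by (simp add: inner inner_swap)
    show "parcs H = (\<Union>e\<in>E. \<Union>i<2 * k e. {(p e i, p e (Suc i)), (p e (Suc i), p e i)})"
    proof -
      have "parcs H = (\<Union>e\<in>E. \<Union>i<2 * k e. {(p e i, p e (Suc i))}) \<union>
          (\<Union>e\<in>E. \<Union>i<2 * k e. {(p e (Suc i), p e i)})"
        unfolding arcs parcs_E UN_Un by (simp add: set_P set_P_swap)
      then show ?thesis by blast
    qed
  next
    fix e assume e: "e \<in> E"
    show "fst e \<noteq> snd e" using e E H0.pair_no_loops by auto
    show "0 < k e" using gen[OF e] len[OF e] by (cases "k e") auto
    show "p e 0 = b (fst e)" using e by (simp add: p_def vs')
    show "p e (2 * k e) = b (snd e)" using e len[OF e] by (simp add: p_def vs nth_append)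
    show "p e i \<notin> b ` ?V" if "0 < i" "i < 2 * k e" for i
    proof -
      have "p e i \<in> set (H.inner_verts (P e))" unfolding inner[OF e] using that by simp
      then show ?thesis using gp[OF e] unfolding H.gen_iapath_def by blast
    qed
    fix e' i j
    assume i: "0 < i" "i < 2 * k e" and e': "e' \<in> E" and j: "0 < j" "j < 2 * k e'"
      and eq: "p e i = p e' j"
    have "p e i \<in> set (H.inner_verts (P e)) \<inter> set (H.inner_verts (P e'))"
      unfolding inner[OF e] inner[OF e'] using i j imageI[of j "{0<..<2 * k e'}" "p e'"]
      by (simp add: eq[symmetric])
    \<comment> \<open>Paths of different edges share no inner vertex, so the unordered edges agree;
      the orientation then excludes the reversed pair, and distinctness of the vertex list gives
      equal positions.\<close>
    then have "{fst e, snd e} = {fst e', snd e'}"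
      using disj[of "fst e" "snd e" "fst e'" "snd e'"] e e' E by auto
    then have "e = e' \<or> e = (snd e', fst e')"
      by (auto simp: doubleton_eq_iff prod_eq_iff)
    then have ee: "e = e'" using anti[of "fst e'" "snd e'"] e e' by auto
    have "distinct (pawalk_verts (b (fst e)) (P e))" using gen[OF e] by simp
    moreover have "length (pawalk_verts (b (fst e)) (P e)) = Suc (2 * k e)"
      using len[OF e] vs[OF e] by simp
    ultimately show "e = e' \<and> i = j"
      using eq i j ee unfolding p_def by (simp add: nth_eq_iff_index_eq)
  qed
  then show ?thesis by blast
qed

theorem theorem2:
  fixes S :: "'g::{finite, ab_group_add} set"
    and H0 :: "'a pair_pre_digraph"
    and H :: "'b pair_pre_digraph"
  assumes "0 \<notin> S" and "uminus ` S = S"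
    and "pair_graph H0" and "pair_graph H"
    and "even_subdivision H0 H"
  shows "hom_density H (Cay S) \<ge> hom_density K2 (Cay S) ^ num_edges H"
  using even_subdivision_path_system[OF assms(3-5)] even_path_system.hom_density_ge[OF _ assms(2)]
  by blast

end
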